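(* Let $A=A^\top\in\mathbb{R}^{n\times n}$ be the adjacency matrix of an undirected, possibly weighted graph on $n$ vertices (nonnegative weights, not assumed connected), with nonsingular diagonal degree matrix $D$. Let $0<\alpha<1$ and $L = I-\alpha D^{-1}A$. Let $x,b\in\mathbb{R}^n$ be nonzero with $Lx=b$ (equivalently, $y=D^{1/2}x$ solves the symmetric positive definite system $Hy=f$ with $H=D^{1/2}LD^{-1/2}$ and $f=D^{1/2}b$), and suppose that $b$ is not collinear with the all-ones vector $\mathbf{1}$, i.e. $\cos_D\angle(b,\mathbf{1})<1$. Then for every $\hat{x}\in\mathbb{R}^n$, with $r=b-L\hat{x}$, $$\frac{1-\alpha}{1+\alpha}\,\frac{\|r\|_D}{\|b\|_D}\;\leqslant\;\frac{\|x-\hat{x}\|_D}{\|x\|_D}\;\leqslant\;\kappa_D(L,b)\,\frac{\|r\|_D}{\|b\|_D},$$ where $$\kappa_D(L,b) := \sqrt{\cos_D^2\angle(x,\mathbf{1})+\sin_D^2\angle(x,\mathbf{1})\Big(\frac{1+\alpha}{1-\alpha}\Big)^2}.$$ Moreover, if $\sin_D\angle(x,\mathbf{1})\leqslant 1-\alpha$, then $\kappa_D(L,b)\leqslant\sqrt{1+(1+\alpha)^2}\leqslant\sqrt{5}$.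
   Context: $D$ is the diagonal matrix whose $i$th diagonal entry is the $i$th row sum of $A$; it is assumed nonsingular (isolated vertices carry a self-loop), so all degrees are positive and $D^{-1}A$ is row-stochastic. $\mathbf{1}\in\mathbb{R}^n$ is the vector of all ones. The $D$-norm is $\|v\|_D=\|D^{1/2}v\|_2=\sqrt{v^\top D v}$. For nonzero $v\in\mathbb{R}^n$, write $v=\mathbf{1}\gamma+w$ with $\gamma\in\mathbb{R}$ and $w^\top D\mathbf{1}=0$; then $\cos_D\angle(v,\mathbf{1})=\|\mathbf{1}\gamma\|_D/\|v\|_D$ and $\sin_D\angle(v,\mathbf{1})=\|w\|_D/\|v\|_D$. *)

theory Defs
  imports "HOL-Analysis.Analysis"
begin

text \<open>
  Throughout, \<open>1 :: real^'n\<close> is the all-ones vector (lemma \<open>one_vec_def\<close>), whereas the identity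
  matrix is \<open>mat 1\<close>.
\<close>

definition adjacency_matrix :: "real^'n^'n \<Rightarrow> bool" where
  "adjacency_matrix A \<longleftrightarrow> transpose A = A \<and> (\<forall>i j. 0 \<le> A $ i $ j)"

definition diag_matrix :: "real^'n \<Rightarrow> real^'n^'n" where
  "diag_matrix d = (\<chi> i j. if i = j then d $ i else 0)"

definition degree_vector :: "real^'n^'n \<Rightarrow> real^'n" where
  "degree_vector A = (\<chi> i. \<Sum>j\<in>UNIV. A $ i $ j)"

definition degree_matrix :: "real^'n^'n \<Rightarrow> real^'n^'n" where
  "degree_matrix A = diag_matrix (degree_vector A)"

definition sqrt_degree_matrix :: "real^'n^'n \<Rightarrow> real^'n^'n" where
  "sqrt_degree_matrix A = diag_matrix (\<chi> i. sqrt (degree_vector A $ i))"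

definition positive_definite :: "real^'n^'n \<Rightarrow> bool" where
  "positive_definite M \<longleftrightarrow> transpose M = M \<and> (\<forall>v. v \<noteq> 0 \<longrightarrow> 0 < v \<bullet> (M *v v))"

definition D_norm :: "real^'n^'n \<Rightarrow> real^'n \<Rightarrow> real" where
  "D_norm D v = sqrt (v \<bullet> (D *v v))"

text \<open>
  The coefficient \<open>\<gamma>\<close> and the remainder \<open>w\<close> in the \<open>D\<close>-orthogonal splitting
  \<open>v = \<gamma> 1 + w\<close>, \<open>w\<^sup>T D 1 = 0\<close>. The coefficient is unique as soon as
  \<open>1\<^sup>T D 1 \<noteq> 0\<close>, in particular for a diagonal \<open>D\<close> with positive diagonal entries.
\<close>

definition ones_coeff :: "real^'n^'n \<Rightarrow> real^'n \<Rightarrow> real" where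
  "ones_coeff D v = (THE \<gamma>. \<exists>w. v = \<gamma> *\<^sub>R 1 + w \<and> w \<bullet> (D *v 1) = 0)"

definition ones_rest :: "real^'n^'n \<Rightarrow> real^'n \<Rightarrow> real^'n" where
  "ones_rest D v = v - ones_coeff D v *\<^sub>R 1"

definition cos_D :: "real^'n^'n \<Rightarrow> real^'n \<Rightarrow> real" where
  "cos_D D v = D_norm D (ones_coeff D v *\<^sub>R 1) / D_norm D v"

definition sin_D :: "real^'n^'n \<Rightarrow> real^'n \<Rightarrow> real" where
  "sin_D D v = D_norm D (ones_rest D v) / D_norm D v"

text \<open>
  The quantity \<open>\<kappa>\<^sub>D(L, b)\<close> for \<open>L = I - \<alpha> D\<^sup>-\<^sup>1 A\<close>. Its formula depends on \<open>b\<close> only through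
  the solution \<open>x\<close> of \<open>L x = b\<close>, which is therefore the argument here.
\<close>

definition kappa_D :: "real^'n^'n \<Rightarrow> real \<Rightarrow> real^'n \<Rightarrow> real" where
  "kappa_D D \<alpha> x =
    sqrt ((cos_D D x)\<^sup>2 + (sin_D D x)\<^sup>2 * ((1 + \<alpha>) / (1 - \<alpha>))\<^sup>2)"

end

theory Submission
  imports Defs
begin

text \<open>
  The walk matrix \<open>P = D\<^sup>-\<^sup>1 A\<close> is a \<open>D\<close>-contraction, since the weighted sum of squares
  \<open>\<Sum> a\<^sub>i\<^sub>j (y\<^sub>i - u\<^sub>j)\<^sup>2 \<ge> 0\<close> says \<open>2 y\<^sup>T A u \<le> \<parallel>y\<parallel>\<^sub>D\<^sup>2 + \<parallel>u\<parallel>\<^sub>D\<^sup>2\<close>, which for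
  \<open>y = P u\<close> is \<open>\<parallel>P u\<parallel>\<^sub>D \<le> \<parallel>u\<parallel>\<^sub>D\<close>. Hence \<open>(1 - \<alpha>) \<parallel>v\<parallel>\<^sub>D \<le> \<parallel>L v\<parallel>\<^sub>D \<le> (1 + \<alpha>) \<parallel>v\<parallel>\<^sub>D\<close>.
  The sharper upper bound comes from \<open>L 1 = (1 - \<alpha>) 1\<close>: since \<open>L\<close> is self-adjoint for the
  \<open>D\<close>-inner product, it preserves the splitting \<open>x = \<gamma> 1 + w\<close>, so
  \<open>\<parallel>b\<parallel>\<^sub>D\<^sup>2 \<le> (1 - \<alpha>)\<^sup>2 \<parallel>\<gamma> 1\<parallel>\<^sub>D\<^sup>2 + (1 + \<alpha>)\<^sup>2 \<parallel>w\<parallel>\<^sub>D\<^sup>2 = ((1 - \<alpha>) \<kappa> \<parallel>x\<parallel>\<^sub>D)\<^sup>2\<close>.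
\<close>

section \<open>Diagonal, inverse and symmetric matrices acting on vectors\<close>

lemma diag_matrix_mult_vec_nth [simp]: "(diag_matrix d *v v) $ i = d $ i * v $ i"
  by (simp add: diag_matrix_def matrix_vector_mult_def if_distrib[of "\<lambda>c. c * _"] cong: if_cong)

lemma transpose_diag_matrix [simp]: "transpose (diag_matrix d) = diag_matrix d"
  by (simp add: diag_matrix_def transpose_def vec_eq_iff)

lemma invertible_diag_matrix_iff: "invertible (diag_matrix d) \<longleftrightarrow> (\<forall>i. d $ i \<noteq> 0)"
  by (simp add: invertible_det_nz det_diagonal diag_matrix_def)

lemma
  fixes M :: "'a::semiring_1^'n^'n"
  assumes "invertible M"
  shows matrix_inv_mult_vec_left [simp]: "matrix_inv M *v (M *v v) = v"
    and matrix_inv_mult_vec_right [simp]: "M *v (matrix_inv M *v v) = v"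
proof -
  have "M ** matrix_inv M = mat 1 \<and> matrix_inv M ** M = mat 1"
    using assms unfolding invertible_def matrix_inv_def by (rule someI_ex)
  then show "matrix_inv M *v (M *v v) = v" and "M *v (matrix_inv M *v v) = v"
    by (simp_all add: matrix_vector_mul_assoc)
qed

lemma inner_symmetric_matrix:
  fixes M :: "real^'n^'n"
  assumes "transpose M = M"
  shows "(M *v u) \<bullet> v = u \<bullet> (M *v v)"
  by (metis assms dot_lmul_matrix transpose_matrix_vector)

text \<open>Serves to prove \<open>H\<close> symmetric: \<open>H\<close> is tractable only through
  its action on vectors \<open>S *v u\<close>, not entrywise.\<close>

lemma transpose_eqI:
  fixes M :: "real^'n^'n"
  assumes "\<And>u v. (M *v u) \<bullet> v = u \<bullet> (M *v v)"
  shows "transpose M = M"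
proof -
  have "transpose M *v u = M *v u" for u
    by (metis assms dot_lmul_matrix transpose_matrix_vector vector_eq_rdot)
  then show ?thesis by (simp add: matrix_eq)
qed

section \<open>The \<open>D\<close>-inner product of a graph and its walk matrix\<close>

locale weighted_graph =
  fixes A D S :: "real^'n^'n"
  assumes adj: "adjacency_matrix A"
    and D_eq: "D = degree_matrix A"
    and D_inv: "invertible D"
    and S_eq: "S = sqrt_degree_matrix A"
begin

abbreviation P :: "real^'n^'n" where "P \<equiv> matrix_inv D ** A"

lemma A_nonneg: "0 \<le> A $ i $ j"
  using adj by (simp add: adjacency_matrix_def)

lemma transpose_A: "transpose A = A"
  using adj by (simp add: adjacency_matrix_def)

lemma A_commute: "A $ i $ j = A $ j $ i"
  using transpose_A by (metis transpose_def vec_lambda_beta)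

lemma degree_pos: "0 < degree_vector A $ i"
proof -
  have "degree_vector A $ i \<noteq> 0"
    using D_inv by (simp add: D_eq degree_matrix_def invertible_diag_matrix_iff)
  moreover have "0 \<le> degree_vector A $ i"
    by (simp add: degree_vector_def A_nonneg sum_nonneg)
  ultimately show ?thesis by simp
qed

lemma S_inv [simp]: "invertible S"
  using degree_pos by (simp add: S_eq sqrt_degree_matrix_def invertible_diag_matrix_iff less_imp_neq[symmetric])

lemma S_mult_S: "S *v (S *v v) = D *v v"
  using degree_pos
  by (simp add: S_eq D_eq sqrt_degree_matrix_def degree_matrix_def vec_eq_iff less_imp_le)

lemma transpose_S: "transpose S = S"
  by (simp add: S_eq sqrt_degree_matrix_def)

lemma inner_S: "(S *v u) \<bullet> (S *v v) = u \<bullet> (D *v v)"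
  by (simp add: inner_symmetric_matrix transpose_S S_mult_S)

text \<open>With \<open>S\<close> as the square root of \<open>D\<close>, the triangle inequality
  and Pythagoras carry over from the Euclidean norm.\<close>

lemma D_norm_eq: "D_norm D v = norm (S *v v)"
  by (simp add: D_norm_def norm_eq_sqrt_inner inner_S)

lemma S_mult_eq_iff: "S *v u = S *v v \<longleftrightarrow> u = v"
  by (metis S_inv matrix_inv_mult_vec_left)

lemma D_norm_pos: "v \<noteq> 0 \<Longrightarrow> 0 < D_norm D v"
  using S_mult_eq_iff[of v 0] by (simp add: D_norm_eq)

lemma D_mult_P: "D *v (P *v v) = A *v v"
  by (simp add: D_inv flip: matrix_vector_mul_assoc)

lemma P_ones: "P *v 1 = 1"
proof -
  have "A *v 1 = D *v 1"
    by (simp add: D_eq degree_matrix_def vec_eq_iff degree_vector_def matrix_vector_mult_def[of A])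
  then show ?thesis
    by (simp add: D_inv flip: matrix_vector_mul_assoc)
qed

lemma inner_A_le: "2 * (y \<bullet> (A *v u)) \<le> y \<bullet> (D *v y) + u \<bullet> (D *v u)"
proof -
  have D: "v \<bullet> (D *v v) = (\<Sum>i\<in>UNIV. \<Sum>j\<in>UNIV. A $ i $ j * (v $ i)\<^sup>2)" for v
    by (simp add: inner_vec_def D_eq degree_matrix_def degree_vector_def sum_distrib_left
        power2_eq_square mult_ac)
  \<comment> \<open>Symmetry of \<open>A\<close> turns row sums into column sums, so the same degree
    weights can be attached to the index \<open>j\<close> carried by \<open>u\<close>.\<close>
  have D': "v \<bullet> (D *v v) = (\<Sum>i\<in>UNIV. \<Sum>j\<in>UNIV. A $ i $ j * (v $ j)\<^sup>2)" for v
    unfolding D by (subst sum.swap) (simp add: A_commute)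
  have "0 \<le> (\<Sum>i\<in>UNIV. \<Sum>j\<in>UNIV. A $ i $ j * (y $ i - u $ j)\<^sup>2)"
    by (simp add: A_nonneg sum_nonneg)
  also have "\<dots> = y \<bullet> (D *v y) + u \<bullet> (D *v u) - 2 * (y \<bullet> (A *v u))"
    unfolding D[of y] D'[of u]
    by (simp add: inner_vec_def matrix_vector_mult_def power2_diff algebra_simps
        sum.distrib sum_subtractf sum_distrib_left)
  finally show ?thesis by simp
qed

lemma D_norm_P_le: "D_norm D (P *v u) \<le> D_norm D u"
  using inner_A_le[of "P *v u" u] by (simp add: D_norm_def D_mult_P)

lemma inner_D_commute: "u \<bullet> (D *v v) = v \<bullet> (D *v u)"
  by (metis inner_S inner_commute)

lemma ones_D_pos: "0 < (1::real^'n) \<bullet> (D *v 1)"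
  using D_norm_pos[of 1] by (simp add: D_norm_def)

text \<open>Pairing a splitting with \<open>D *v 1\<close> kills \<open>w\<close> and determines the
  coefficient because \<open>1 \<bullet> (D *v 1)\<close> is positive; this discharges the
  description operator.\<close>

lemma ones_coeff_eq: "ones_coeff D v = v \<bullet> (D *v 1) / (1 \<bullet> (D *v 1))"
  unfolding ones_coeff_def
proof (rule the_equality)
  let ?g = "v \<bullet> (D *v 1) / (1 \<bullet> (D *v 1))"
  show "\<exists>w. v = ?g *\<^sub>R 1 + w \<and> w \<bullet> (D *v 1) = 0"
    using ones_D_pos by (intro exI[of _ "v - ?g *\<^sub>R 1"]) (simp add: inner_diff_left)
next
  fix g assume "\<exists>w. v = g *\<^sub>R 1 + w \<and> w \<bullet> (D *v 1) = 0"
  then show "g = v \<bullet> (D *v 1) / (1 \<bullet> (D *v 1))"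
    using ones_D_pos by (auto simp: inner_add_left)
qed

lemma ones_rest_orthogonal: "ones_rest D v \<bullet> (D *v 1) = 0"
  using ones_D_pos by (simp add: ones_rest_def ones_coeff_eq inner_diff_left)

lemma D_norm_pythagoras:
  assumes "w \<bullet> (D *v 1) = 0"
  shows "(D_norm D (c *\<^sub>R 1 + w))\<^sup>2 = (D_norm D (c *\<^sub>R 1))\<^sup>2 + (D_norm D w)\<^sup>2"
proof -
  have "orthogonal (S *v (c *\<^sub>R 1)) (S *v w)"
    using assms inner_D_commute[of w 1] by (simp add: orthogonal_def inner_S)
  then show ?thesis
    by (simp add: D_norm_eq norm_add_Pythagorean matrix_vector_right_distrib)
qed

lemma D_norm_ones_split: "(D_norm D v)\<^sup>2 = (D_norm D (ones_coeff D v *\<^sub>R 1))\<^sup>2 + (D_norm D (ones_rest D v))\<^sup>2"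
  using D_norm_pythagoras[OF ones_rest_orthogonal, of "ones_coeff D v" v]
  by (simp add: ones_rest_def)

lemma cos_D_squared_add_sin_D_squared:
  assumes "v \<noteq> 0" shows "(cos_D D v)\<^sup>2 + (sin_D D v)\<^sup>2 = 1"
  using D_norm_pos[OF assms]
  by (simp add: cos_D_def sin_D_def power_divide flip: add_divide_distrib D_norm_ones_split)

end

section \<open>The damped operator \<open>L\<close>: self-adjointness, norm bounds,
  definiteness\<close>

locale damped_walk = weighted_graph A D S for A D S :: "real^'n^'n" +
  fixes \<alpha> :: real and L :: "real^'n^'n"
  assumes \<alpha>_pos: "0 < \<alpha>" and \<alpha>_less_1: "\<alpha> < 1"
    and L_eq: "L = mat 1 - \<alpha> *\<^sub>R P"
begin

lemma L_mult: "L *v v = v - \<alpha> *\<^sub>R (P *v v)"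
  by (simp add: L_eq matrix_vector_mult_diff_rdistrib scaleR_matrix_vector_assoc)

lemma L_ones: "L *v (c *\<^sub>R 1) = (1 - \<alpha>) *\<^sub>R (c *\<^sub>R 1)"
  by (simp add: L_mult P_ones matrix_vector_mult_scaleR algebra_simps)

lemma inner_D_L: "u \<bullet> (D *v (L *v v)) = u \<bullet> (D *v v) - \<alpha> * (u \<bullet> (A *v v))"
  by (simp add: L_mult matrix_vector_mult_diff_distrib matrix_vector_mult_scaleR D_mult_P
      inner_diff_right)

text \<open>The product of \<open>D\<close> and \<open>L\<close> is \<open>D\<close> minus \<alpha>
  times \<open>A\<close>, a symmetric matrix.\<close>

lemma inner_D_L_commute: "u \<bullet> (D *v (L *v v)) = v \<bullet> (D *v (L *v u))"
  using inner_symmetric_matrix[OF transpose_A, of u v]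
  by (simp add: inner_D_L inner_D_commute[of u v] inner_commute)

lemma D_norm_L_le: "D_norm D (L *v v) \<le> (1 + \<alpha>) * D_norm D v"
  and D_norm_L_ge: "(1 - \<alpha>) * D_norm D v \<le> D_norm D (L *v v)"
proof -
  have S: "S *v (L *v v) = S *v v - \<alpha> *\<^sub>R (S *v (P *v v))"
    by (simp add: L_mult matrix_vector_mult_diff_distrib matrix_vector_mult_scaleR)
  have "norm (\<alpha> *\<^sub>R (S *v (P *v v))) \<le> \<alpha> * norm (S *v v)"
    using D_norm_P_le[of v] \<alpha>_pos by (simp add: D_norm_eq)
  then show "D_norm D (L *v v) \<le> (1 + \<alpha>) * D_norm D v"
    and "(1 - \<alpha>) * D_norm D v \<le> D_norm D (L *v v)"
    using norm_triangle_ineq4[of "S *v v" "\<alpha> *\<^sub>R (S *v (P *v v))"]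
      norm_triangle_ineq2[of "S *v v" "\<alpha> *\<^sub>R (S *v (P *v v))"]
    unfolding D_norm_eq S by (simp_all add: algebra_simps)
qed

lemma similar_mult: "(S ** L ** matrix_inv S) *v (S *v u) = S *v (L *v u)"
  by (simp flip: matrix_vector_mul_assoc)

lemma positive_definite_similar: "positive_definite (S ** L ** matrix_inv S)"
    (is "positive_definite ?H")
proof -
  have inner_H: "(S *v u) \<bullet> (?H *v (S *v v)) = u \<bullet> (D *v (L *v v))" for u v
    by (simp add: similar_mult inner_S)
  \<comment> \<open>Every vector has the form \<open>S *v u\<close>, so statements about
    \<open>H\<close> reduce to the \<open>D\<close>-form of \<open>L\<close>.\<close>
  have surj: "\<exists>u. v = S *v u" for v
    by (metis S_inv matrix_inv_mult_vec_right)
  have "(?H *v u) \<bullet> v = u \<bullet> (?H *v v)" for u v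
    using surj[of u] surj[of v] by (metis inner_H inner_D_L_commute inner_commute)
  moreover have "0 < v \<bullet> (?H *v v)" if "v \<noteq> 0" for v
  proof -
    obtain u where u: "v = S *v u"
      using surj by blast
    then have D: "0 < u \<bullet> (D *v u)"
      using that by (metis inner_S inner_gt_zero_iff)
    \<comment> \<open>The case \<open>y = u\<close> of \<open>inner_A_le\<close> bounds the form of
      \<open>A\<close> by that of \<open>D\<close>; the damping factor then makes the inequality
      strict.\<close>
    have "\<alpha> * (u \<bullet> (A *v u)) \<le> \<alpha> * (u \<bullet> (D *v u))"
      using inner_A_le[of u u] \<alpha>_pos by simp
    also have "\<dots> < u \<bullet> (D *v u)"
      using D \<alpha>_less_1 by simp
    finally show ?thesis
      by (simp add: u inner_H inner_D_L)
  qed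
  ultimately show ?thesis
    by (simp add: positive_definite_def transpose_eqI)
qed

lemma D_norm_L_le_kappa:
  assumes "x \<noteq> 0"
  shows "D_norm D (L *v x) \<le> (1 - \<alpha>) * kappa_D D \<alpha> x * D_norm D x"
proof (rule power2_le_imp_le)
  define g where "g = D_norm D (ones_coeff D x *\<^sub>R 1)"
  define w where "w = ones_rest D x"
  have x: "x = ones_coeff D x *\<^sub>R 1 + w"
    by (simp add: w_def ones_rest_def)
  have w: "w \<bullet> (D *v 1) = 0"
    by (simp add: w_def ones_rest_orthogonal)
  \<comment> \<open>Self-adjointness moves \<open>L\<close> onto its eigenvector \<open>1\<close>,
    so \<open>L *v w\<close> stays \<open>D\<close>-orthogonal to \<open>1\<close> and Pythagoras
    applies to \<open>L *v x\<close>.\<close>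
  have "(L *v w) \<bullet> (D *v 1) = w \<bullet> (D *v (L *v 1))"
    by (metis inner_D_commute inner_D_L_commute)
  then have Lw: "(L *v w) \<bullet> (D *v 1) = 0"
    using w L_ones[of 1] by (simp add: matrix_vector_mult_scaleR)
  have "L *v x = ((1 - \<alpha>) * ones_coeff D x) *\<^sub>R 1 + L *v w"
    by (subst x) (simp add: matrix_vector_right_distrib L_ones)
  then have "(D_norm D (L *v x))\<^sup>2
      = (D_norm D (((1 - \<alpha>) * ones_coeff D x) *\<^sub>R 1))\<^sup>2 + (D_norm D (L *v w))\<^sup>2"
    by (simp add: D_norm_pythagoras Lw)
  also have "D_norm D (((1 - \<alpha>) * ones_coeff D x) *\<^sub>R 1) = (1 - \<alpha>) * g"
    using \<alpha>_less_1 by (simp add: g_def D_norm_eq matrix_vector_mult_scaleR abs_mult)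
  \<comment> \<open>The component along \<open>1\<close> is scaled exactly; only the remainder needs
    the general bound \<open>1 + \<alpha>\<close>.\<close>
  also have "((1 - \<alpha>) * g)\<^sup>2 + (D_norm D (L *v w))\<^sup>2
      \<le> ((1 - \<alpha>) * g)\<^sup>2 + ((1 + \<alpha>) * D_norm D w)\<^sup>2"
    by (intro add_left_mono power_mono D_norm_L_le) (simp add: D_norm_eq)
  also have "\<dots> = ((1 - \<alpha>) * kappa_D D \<alpha> x * D_norm D x)\<^sup>2"
  proof -
    have "(kappa_D D \<alpha> x)\<^sup>2
        = (g / D_norm D x)\<^sup>2 + (D_norm D w / D_norm D x)\<^sup>2 * ((1 + \<alpha>) / (1 - \<alpha>))\<^sup>2"
      by (simp add: kappa_D_def cos_D_def sin_D_def flip: g_def w_def)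
    then show ?thesis
      using D_norm_pos[OF assms] \<alpha>_less_1
      unfolding power_mult_distrib by (simp add: power_divide distrib_left distrib_right)
  qed
  finally show "(D_norm D (L *v x))\<^sup>2 \<le> ((1 - \<alpha>) * kappa_D D \<alpha> x * D_norm D x)\<^sup>2" .
  show "0 \<le> (1 - \<alpha>) * kappa_D D \<alpha> x * D_norm D x"
    using \<alpha>_less_1 by (simp add: kappa_D_def D_norm_eq)
qed

section \<open>Relative error against relative residual\<close>

lemma relative_error_ge:
  assumes "x \<noteq> 0"
  shows "(1 - \<alpha>) / (1 + \<alpha>) * (D_norm D (L *v e) / D_norm D (L *v x))
    \<le> D_norm D e / D_norm D x"
proof -
  have x: "0 < (1 - \<alpha>) * D_norm D x"
    using D_norm_pos[OF assms] \<alpha>_less_1 by simp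
  have "D_norm D (L *v e) / D_norm D (L *v x) \<le> (1 + \<alpha>) * D_norm D e / ((1 - \<alpha>) * D_norm D x)"
    using x \<alpha>_pos by (intro frac_le D_norm_L_le D_norm_L_ge) (simp_all add: D_norm_eq)
  then have "(1 - \<alpha>) / (1 + \<alpha>) * (D_norm D (L *v e) / D_norm D (L *v x))
      \<le> (1 - \<alpha>) / (1 + \<alpha>) * ((1 + \<alpha>) * D_norm D e / ((1 - \<alpha>) * D_norm D x))"
    using \<alpha>_pos \<alpha>_less_1 by (intro mult_left_mono) simp_all
  also have "\<dots> = D_norm D e / D_norm D x"
    using \<alpha>_pos \<alpha>_less_1 by simp
  finally show ?thesis .
qed

lemma relative_error_le:
  assumes "x \<noteq> 0"
  shows "D_norm D e / D_norm D x
    \<le> kappa_D D \<alpha> x * (D_norm D (L *v e) / D_norm D (L *v x))"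
proof -
  have x: "0 < D_norm D x"
    using D_norm_pos[OF assms] .
  then have Lx: "0 < D_norm D (L *v x)"
    using D_norm_L_ge[of x] \<alpha>_less_1 by (smt (verit) mult_pos_pos)
  \<comment> \<open>Using \<open>D_norm_L_le\<close> for \<open>x\<close> here would give only the
    factor \<open>(1 + \<alpha>) / (1 - \<alpha>)\<close>; the bound adapted to \<open>x\<close>
    gives \<open>kappa_D\<close>.\<close>
  have "((1 - \<alpha>) * D_norm D e) * D_norm D (L *v x)
      \<le> D_norm D (L *v e) * ((1 - \<alpha>) * kappa_D D \<alpha> x * D_norm D x)"
    by (intro mult_mono D_norm_L_ge D_norm_L_le_kappa assms) (simp_all add: D_norm_eq)
  then have "(1 - \<alpha>) * (D_norm D e * D_norm D (L *v x))
      \<le> (1 - \<alpha>) * (kappa_D D \<alpha> x * D_norm D (L *v e) * D_norm D x)"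
    by (simp add: mult_ac)
  then have "D_norm D e * D_norm D (L *v x) \<le> kappa_D D \<alpha> x * D_norm D (L *v e) * D_norm D x"
    using \<alpha>_less_1 by simp
  then show ?thesis
    using x Lx by (simp add: divide_simps mult_ac)
qed

text \<open>A small sine cancels the denominator \<open>1 - \<alpha>\<close> of the amplified term,
  while the cosine is at most 1.\<close>

lemma kappa_D_le:
  assumes "x \<noteq> 0" and "sin_D D x \<le> 1 - \<alpha>"
  shows "kappa_D D \<alpha> x \<le> sqrt (1 + (1 + \<alpha>)\<^sup>2)"
  unfolding kappa_D_def
proof (intro real_sqrt_le_mono add_mono)
  show "(cos_D D x)\<^sup>2 \<le> 1"
    using cos_D_squared_add_sin_D_squared[OF assms(1)] zero_le_power2[of "sin_D D x"] by linarith
  have "(sin_D D x)\<^sup>2 \<le> (1 - \<alpha>)\<^sup>2"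
    using assms(2) by (intro power_mono) (simp_all add: sin_D_def D_norm_eq)
  then have "(sin_D D x)\<^sup>2 * ((1 + \<alpha>) / (1 - \<alpha>))\<^sup>2 \<le> (1 - \<alpha>)\<^sup>2 * ((1 + \<alpha>) / (1 - \<alpha>))\<^sup>2"
    by (rule mult_right_mono) simp
  also have "\<dots> = (1 + \<alpha>)\<^sup>2"
    using \<alpha>_less_1 by (simp add: power_divide)
  finally show "(sin_D D x)\<^sup>2 * ((1 + \<alpha>) / (1 - \<alpha>))\<^sup>2 \<le> (1 + \<alpha>)\<^sup>2" .
qed

end

theorem proposition1:
  fixes A D S L H :: "real^'n^'n" and \<alpha> :: real and x b :: "real^'n"
  assumes "adjacency_matrix A"
    and "D = degree_matrix A" and "invertible D"
    and "0 < \<alpha>" and "\<alpha> < 1"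
    and "L = mat 1 - \<alpha> *\<^sub>R (matrix_inv D ** A)"
    and "S = sqrt_degree_matrix A"
    and "H = S ** L ** matrix_inv S"
    and "x \<noteq> 0" and "b \<noteq> 0" and "L *v x = b"
    and "cos_D D b < 1"
  shows "positive_definite H
    \<and> (\<forall>u c. L *v u = c \<longleftrightarrow> H *v (S *v u) = S *v c)
    \<and> (\<forall>xhat r. r = b - L *v xhat \<longrightarrow>
         (1 - \<alpha>) / (1 + \<alpha>) * (D_norm D r / D_norm D b) \<le> D_norm D (x - xhat) / D_norm D x
       \<and> D_norm D (x - xhat) / D_norm D x \<le> kappa_D D \<alpha> x * (D_norm D r / D_norm D b))
    \<and> (sin_D D x \<le> 1 - \<alpha> \<longrightarrow>
         kappa_D D \<alpha> x \<le> sqrt (1 + (1 + \<alpha>)\<^sup>2) \<and> sqrt (1 + (1 + \<alpha>)\<^sup>2) \<le> sqrt 5)"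
proof -
  interpret damped_walk A D S \<alpha> L
    by unfold_locales (use assms in simp_all)
  have "L *v u = c \<longleftrightarrow> H *v (S *v u) = S *v c" for u c
    using \<open>H = S ** L ** matrix_inv S\<close> by (simp add: similar_mult S_mult_eq_iff)
  moreover have "(1 - \<alpha>) / (1 + \<alpha>) * (D_norm D r / D_norm D b) \<le> D_norm D (x - xhat) / D_norm D x
      \<and> D_norm D (x - xhat) / D_norm D x \<le> kappa_D D \<alpha> x * (D_norm D r / D_norm D b)"
    if "r = b - L *v xhat" for xhat r
  proof -
    \<comment> \<open>The residual is the image of the error, so both bounds apply with
      \<open>e = x - xhat\<close>.\<close>
    have "r = L *v (x - xhat)"
      using that \<open>L *v x = b\<close> by (simp add: matrix_vector_mult_diff_distrib)
    then show ?thesis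
      using relative_error_ge relative_error_le \<open>x \<noteq> 0\<close> \<open>L *v x = b\<close> by blast
  qed
  moreover have "sqrt (1 + (1 + \<alpha>)\<^sup>2) \<le> sqrt 5"
    using power_mono[of "1 + \<alpha>" 2 2] \<alpha>_pos \<alpha>_less_1 by simp
  ultimately show ?thesis
    using positive_definite_similar kappa_D_le \<open>x \<noteq> 0\<close> \<open>H = S ** L ** matrix_inv S\<close> by blast
qed

end
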